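(* Let $M=(m_{ij})$ be a non-zero binary matrix of size $n\times m$ with distinct rows $M_{1-},\dots,M_{n-}$. Suppose that for every pair of rows $M_{i-}$ and $M_{j-}$ ($i,j\in\{1,\dots,n\}$, not necessarily distinct) the vector $\neg M_{i-}\lor M_{j-}$ is a row of $M$. Then there exists a column $k\in\{1,\dots,m\}$ of $M$ that contains at least $n/2$ ones, i.e. $\sum_{i=1}^{n} m_{ik}\ge n/2$.
   Context: A binary matrix is a matrix with entries in $\{0,1\}$; it is non-zero if at least one entry equals $1$. $M_{i-}$ denotes the $i$-th row of $M$. The logical operations $\neg$ (negation) and $\lor$ (disjunction) act entrywise on binary vectors, with $1$ as true and $0$ as false. *)

theory Defs
  imports Complex_Main "Jordan_Normal_Form.Matrix"
begin

definition binary_mat :: "nat mat \<Rightarrow> bool" where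
  "binary_mat M \<longleftrightarrow> elements_mat M \<subseteq> {0, 1}"

definition nonzero_binary_mat :: "nat mat \<Rightarrow> bool" where
  "nonzero_binary_mat M \<longleftrightarrow> binary_mat M \<and> 1 \<in> elements_mat M"

(* Truth value of an entry: 1 is true; the operations below are only meant for 0/1 entries. *)

definition vec_not :: "nat vec \<Rightarrow> nat vec" where
  "vec_not v = vec (dim_vec v) (\<lambda>i. of_bool (\<not> v $ i = 1))"

definition vec_or :: "nat vec \<Rightarrow> nat vec \<Rightarrow> nat vec" where
  "vec_or v w = vec (dim_vec v) (\<lambda>i. of_bool (v $ i = 1 \<or> w $ i = 1))"

end

theory Submission
  imports Defs
begin

text \<open>
  Read the rows as subsets of the set of columns; closure under implication gives closure under
  union, since \<open>A \<union> B = (A \<rightarrow> B) \<rightarrow> B\<close>. Let \<open>A\<close> be maximal among the rows other than the full one and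
  let \<open>k \<notin> A\<close>. If \<open>k \<notin> B\<close> then \<open>A \<union> B\<close> is not full, so \<open>B \<subseteq> A\<close> by maximality. Hence \<open>B \<mapsto> (A \<rightarrow> B)\<close>,
  which is undone by intersecting with \<open>A\<close>, injects the rows avoiding \<open>k\<close> into those containing \<open>k\<close>.
\<close>

lemma implication_closed_abundant_element:
  fixes F :: "'a set set" and X :: "'a set"
  assumes "finite F" and sub: "F \<subseteq> Pow X" and "X \<noteq> {}"
    and imp: "\<And>A B. A \<in> F \<Longrightarrow> B \<in> F \<Longrightarrow> (X - A) \<union> B \<in> F"
  shows "\<exists>k\<in>X. card F \<le> 2 * card {A \<in> F. k \<in> A}"
proof (cases "F \<subseteq> {X}")
  \<comment> \<open>There is no maximal \<open>A\<close> to choose here, but every member is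
    \<open>X\<close>, so any \<open>k\<close> in \<open>X\<close> lies in all of them.\<close>
  case True
  obtain k where "k \<in> X" using \<open>X \<noteq> {}\<close> by blast
  with True have "{A \<in> F. k \<in> A} = F" by blast
  with \<open>k \<in> X\<close> show ?thesis by (intro bexI[of _ k]) auto
next
  case False
  have union: "A \<union> B \<in> F" if "A \<in> F" "B \<in> F" for A B
  proof -
    \<comment> \<open>As \<open>A \<subseteq> X\<close>, the complement of
      \<open>(X - A) \<union> B\<close> in \<open>X\<close> is \<open>A - B\<close>.\<close>
    have "A \<union> B = (X - ((X - A) \<union> B)) \<union> B" using that sub by blast
    then show ?thesis using imp that by presburger
  qed
  from False \<open>finite F\<close> obtain A where A: "A \<in> F - {X}"
    and max: "\<And>B. B \<in> F - {X} \<Longrightarrow> A \<subseteq> B \<Longrightarrow> A = B"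
    using finite_has_maximal[of "F - {X}"] by auto
  obtain k where k: "k \<in> X" "k \<notin> A" using A sub by blast
  have below: "B \<subseteq> A" if "B \<in> F" "k \<notin> B" for B
    using max[of "A \<union> B"] union[of A B] A k that by blast
  have "card {B \<in> F. k \<notin> B} \<le> card {B \<in> F. k \<in> B}"
  proof (rule card_inj_on_le)
    show "inj_on (\<lambda>B. (X - A) \<union> B) {B \<in> F. k \<notin> B}"
      using below by (intro inj_on_inverseI[where g = "\<lambda>C. C \<inter> A"]) blast
    \<comment> \<open>\<open>k\<close> lies in \<open>X - A\<close>, hence in every image, whatever
      \<open>B\<close> is.\<close>
    show "(\<lambda>B. (X - A) \<union> B) ` {B \<in> F. k \<notin> B} \<subseteq> {B \<in> F. k \<in> B}"
      using imp A k by auto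
  qed (use \<open>finite F\<close> in simp)
  moreover have "card F = card {B \<in> F. k \<in> B} + card {B \<in> F. k \<notin> B}"
    using \<open>finite F\<close> by (subst card_Un_disjoint[symmetric]) (auto intro: arg_cong[where f = card])
  ultimately show ?thesis using k by (intro bexI[of _ k]) auto
qed

theorem theorem1p1:
  fixes M :: "nat mat" and n m :: nat
  assumes "M \<in> carrier_mat n m"
    and "nonzero_binary_mat M"
    and "distinct (rows M)"
    and "\<And>i j. i < n \<Longrightarrow> j < n \<Longrightarrow> vec_or (vec_not (row M i)) (row M j) \<in> set (rows M)"
  shows "\<exists>k<m. real (\<Sum>i<n. M $$ (i, k)) \<ge> real n / 2"
proof -
  have dim: "dim_row M = n" "dim_col M = m" using assms(1) by auto
  have bin: "M $$ (i, k) \<in> {0, 1}" if "i < n" "k < m" for i k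
    using assms(1,2) that unfolding nonzero_binary_mat_def binary_mat_def by blast
  \<comment> \<open>An entry 1 must sit in some column; this makes the ground set
    \<open>{..<m}\<close> non-empty.\<close>
  have "0 < m"
    using assms(2) dim unfolding nonzero_binary_mat_def elements_mat_def by auto
  define S where "S i = {k. k < m \<and> M $$ (i, k) = 1}" for i
  \<comment> \<open>A 0/1 row is determined by its support \<open>S i\<close>, so distinct rows
    allow sets of the family to be counted by row indices.\<close>
  have inj: "inj_on S {..<n}"
  proof (rule inj_onI)
    fix i j assume ij: "i \<in> {..<n}" "j \<in> {..<n}" and eq: "S i = S j"
    have "row M i = row M j"
    proof (rule eq_vecI)
      fix k assume "k < dim_vec (row M j)"
      then have k: "k < m" using dim by simp
      from eq k have "M $$ (i, k) = 1 \<longleftrightarrow> M $$ (j, k) = 1" unfolding S_def by blast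
      with bin[of i k] bin[of j k] ij k have "M $$ (i, k) = M $$ (j, k)" by auto
      then show "row M i $ k = row M j $ k" using ij k dim by simp
    qed simp
    then have "rows M ! i = rows M ! j" using ij dim by simp
    then show "i = j" using nth_eq_iff_index_eq[OF assms(3)] ij dim by simp
  qed
  have "({..<m} - A) \<union> B \<in> S ` {..<n}" if AB: "A \<in> S ` {..<n}" "B \<in> S ` {..<n}" for A B
  proof -
    from AB obtain i j where i: "i < n" "A = S i" and j: "j < n" "B = S j" by auto
    from assms(4)[OF i(1) j(1)] obtain l
      where l: "l < n" "row M l = vec_or (vec_not (row M i)) (row M j)"
      using dim by (auto simp: rows_def)
    \<comment> \<open>Both vector operations yield length \<open>m\<close> here, so below
      \<open>m\<close> their defining formulas give the entries.\<close>
    have "M $$ (l, k) = 1 \<longleftrightarrow> M $$ (i, k) \<noteq> 1 \<or> M $$ (j, k) = 1" if "k < m" for k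
      using arg_cong[OF l(2), of "\<lambda>v. v $ k"] that i j l(1) dim
      by (simp add: vec_or_def vec_not_def)
    then have "S l = ({..<m} - A) \<union> B" unfolding i j S_def by blast
    then show ?thesis using l(1) by blast
  qed
  then obtain k where k: "k < m"
    and le: "card (S ` {..<n}) \<le> 2 * card {A \<in> S ` {..<n}. k \<in> A}"
    using implication_closed_abundant_element[of "S ` {..<n}" "{..<m}"] \<open>0 < m\<close>
    by (auto simp: S_def)
  have "{A \<in> S ` {..<n}. k \<in> A} = S ` {i \<in> {..<n}. k \<in> S i}" by blast
  then have "card {A \<in> S ` {..<n}. k \<in> A} = card {i \<in> {..<n}. k \<in> S i}"
    using inj by (auto intro: card_image inj_on_subset)
  also have "\<dots> = (\<Sum>i<n. of_bool (k \<in> S i))"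
    by (simp add: Int_def)
  \<comment> \<open>A binary entry equals the indicator of its being 1, which turns the count into
    the column sum.\<close>
  also have "\<dots> = (\<Sum>i<n. M $$ (i, k))"
    using bin k by (intro sum.cong) (auto simp: S_def)
  finally have "n \<le> 2 * (\<Sum>i<n. M $$ (i, k))"
    using le card_image[OF inj] by simp
  then have "real n / 2 \<le> real (\<Sum>i<n. M $$ (i, k))" by linarith
  with k show ?thesis by blast
qed

end
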